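(* Let $\mathbf f$ be a finite sequence over $\{-1,1\}$ of length at least $2$, and define $$\mathbf g:=\begin{cases}1\,(-x), & \text{if } \mathbf f=1\,1\,x;\\ (-1)\,(-x), & \text{if } \mathbf f=1\,(-1)\,x;\\ (-1)\,x, & \text{if } \mathbf f=(-1)\,1\,x;\\ 1\,x, & \text{if } \mathbf f=(-1)\,(-1)\,x,\end{cases}$$ where $x$ is a (possibly empty) sequence over $\{-1,1\}$. Then $E_{\mathbf f}[n]+\epsilon_n=2n$ for $1\le n<2^{|\mathbf f|-1}$, where $\epsilon_n=0$ if $P_{\mathbf g}[n]=1$ and $\epsilon_n=1$ if $P_{\mathbf g}[n]=-1$. Furthermore, if $\mathbf f$ is an infinite sequence over $\{-1,1\}$ and $\mathbf g$ is defined by the same rule (with $x$ infinite), then $E_{\mathbf f}[n]+\epsilon_n=2n$ holds for all $n\ge1$.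
   Context: For a finite sequence $\mathbf f$ over $\{-1,1\}$ define $P_\epsilon=\epsilon$ (empty) and $P_{\mathbf f a}=P_{\mathbf f}\ a\ (-P_{\mathbf f}^R)$ for $a\in\{-1,1\}$, where $-x$ negates every entry and $x^R$ is reversal; $|P_{\mathbf f}|=2^{|\mathbf f|}-1$. For an infinite $\mathbf f=f_0f_1\cdots$, $P_{\mathbf f}$ is the unique infinite sequence having every $P_{f_0\cdots f_n}$ as a prefix. Paperfolding sequences are indexed from $1$: $P_{\mathbf f}=P_{\mathbf f}[1]P_{\mathbf f}[2]\cdots$. A run is a maximal block of consecutive identical entries; runs are numbered left to right from $1$, and $E_{\mathbf f}[n]$ is the position of the last entry of the $n$-th run of $P_{\mathbf f}$. *)

theory Defs
  imports Main "HOL-Library.Stream"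
begin

text \<open>
  Finite sequences are lists and infinite sequences are streams, with entries of type int.
  The alphabet \<open>{-1, 1}\<close> is imposed by hypotheses on \<open>set\<close> and \<open>sset\<close>.
\<close>

definition paperfold :: "int list \<Rightarrow> int list" where
  "paperfold f = foldl (\<lambda>p a. p @ [a] @ map uminus (rev p)) [] f"

lemma paperfold_Nil [simp]: "paperfold [] = []"
  by (simp add: paperfold_def)

lemma paperfold_snoc [simp]:
  "paperfold (f @ [a]) = paperfold f @ [a] @ map uminus (rev (paperfold f))"
  by (simp add: paperfold_def)

lemma length_paperfold: "length (paperfold f) = 2 ^ length f - 1"
proof (induction f rule: rev_induct)
  case (snoc a f)
  have "(1::nat) \<le> 2 ^ length f" by simp
  with snoc show ?case by simp
qed simp

definition paperfold_inf :: "int stream \<Rightarrow> int stream" where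
  "paperfold_inf f =
     (THE s. \<forall>n. stake (length (paperfold (stake (Suc n) f))) s = paperfold (stake (Suc n) f))"

lemma paperfold_inf_ex1:
  "\<exists>!s. \<forall>n. stake (length (paperfold (stake (Suc n) f))) s = paperfold (stake (Suc n) f)"
proof -
  define p where "p n = paperfold (stake n f)" for n
  have len: "length (p n) = 2 ^ n - 1" for n
    by (simp add: p_def length_paperfold)
  have gt: "n < length (p (Suc n))" for n
    using less_exp[of "Suc n"] unfolding len by linarith
  have step: "\<exists>ys. p (Suc n) = p n @ ys" for n
    unfolding p_def stake_Suc paperfold_snoc by blast
  have mono: "\<exists>ys. p (m + k) = p m @ ys" for m k
  proof (induction k)
    case (Suc k)
    then obtain ys where "p (m + k) = p m @ ys" by blast
    moreover obtain zs where "p (Suc (m + k)) = p (m + k) @ zs" using step by blast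
    ultimately show ?case by simp
  qed simp
  have agree: "p m ! i = p n ! i" if "i < length (p m)" "m \<le> n" for i m n
  proof -
    obtain ys where "p (m + (n - m)) = p m @ ys" using mono by blast
    with that show ?thesis by (simp add: nth_append)
  qed
  have agree': "p m ! i = p n ! i" if "i < length (p m)" "i < length (p n)" for i m n
    using agree[OF that(1), of n] agree[OF that(2), of m] by (metis nat_le_linear)
  define t where "t = smap (\<lambda>i. p (Suc i) ! i) nats"
  have t: "t !! i = p (Suc i) ! i" for i
    by (simp add: t_def)
  have "\<exists>!s. \<forall>n. stake (length (p (Suc n))) s = p (Suc n)"
  proof (rule ex1I[of _ t])
    show "\<forall>n. stake (length (p (Suc n))) t = p (Suc n)"
    proof (intro allI nth_equalityI)
      fix n i assume "i < length (stake (length (p (Suc n))) t)"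
      then have i: "i < length (p (Suc n))" by simp
      show "stake (length (p (Suc n))) t ! i = p (Suc n) ! i"
        unfolding stake_nth[OF i] t by (rule agree'[OF gt i])
    qed simp
  next
    fix s assume s: "\<forall>n. stake (length (p (Suc n))) s = p (Suc n)"
    have "s !! i = t !! i" for i
      using stake_nth[OF gt[of i], of s] s by (simp add: t)
    then show "s = t"
      by (metis stream_smap_nats stream.map_cong0)
  qed
  then show ?thesis unfolding p_def .
qed

text \<open>
  Runs are defined for a word \<open>w\<close> whose set of positions is \<open>D\<close>, so that finite and
  infinite words are treated alike; a block is given by its first and last position.
\<close>

definition const_block :: "nat set \<Rightarrow> (nat \<Rightarrow> 'a) \<Rightarrow> nat \<Rightarrow> nat \<Rightarrow> bool" where
  "const_block D w i j \<longleftrightarrow> i \<le> j \<and> {i..j} \<subseteq> D \<and> (\<forall>k\<in>{i..j}. w k = w i)"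

definition is_run :: "nat set \<Rightarrow> (nat \<Rightarrow> 'a) \<Rightarrow> nat \<Rightarrow> nat \<Rightarrow> bool" where
  "is_run D w i j \<longleftrightarrow> const_block D w i j \<and>
     (\<forall>i' j'. const_block D w i' j' \<and> {i..j} \<subseteq> {i'..j'} \<longrightarrow> i' = i \<and> j' = j)"

text \<open>The \<open>n\<close>-th run from the left is the one with exactly \<open>n - 1\<close> runs to its left.\<close>

definition run_end :: "nat set \<Rightarrow> (nat \<Rightarrow> 'a) \<Rightarrow> nat \<Rightarrow> nat" where
  "run_end D w n =
     (THE e. \<exists>i. is_run D w i e \<and> card {(i', j'). is_run D w i' j' \<and> j' < i} + 1 = n)"

text \<open>Positions in paperfolding sequences start at 1, whereas list and stream indices start at 0.\<close>

definition pf_nth :: "int list \<Rightarrow> nat \<Rightarrow> int" where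
  "pf_nth f k = paperfold f ! (k - 1)"

definition pf_inf_nth :: "int stream \<Rightarrow> nat \<Rightarrow> int" where
  "pf_inf_nth f k = paperfold_inf f !! (k - 1)"

definition pf_run_end :: "int list \<Rightarrow> nat \<Rightarrow> nat" where
  "pf_run_end f n = run_end {1..length (paperfold f)} (pf_nth f) n"

definition pf_inf_run_end :: "int stream \<Rightarrow> nat \<Rightarrow> nat" where
  "pf_inf_run_end f n = run_end {1..} (pf_inf_nth f) n"

definition companion :: "int list \<Rightarrow> int list" where
  "companion f =
     (let x = drop 2 f in
      if take 2 f = [1, 1] then 1 # map uminus x
      else if take 2 f = [1, -1] then -1 # map uminus x
      else if take 2 f = [-1, 1] then -1 # x
      else if take 2 f = [-1, -1] then 1 # x
      else undefined)"

definition companion_inf :: "int stream \<Rightarrow> int stream" where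
  "companion_inf f =
     (let x = sdrop 2 f in
      if stake 2 f = [1, 1] then 1 ## smap uminus x
      else if stake 2 f = [1, -1] then -1 ## smap uminus x
      else if stake 2 f = [-1, 1] then -1 ## x
      else if stake 2 f = [-1, -1] then 1 ## x
      else undefined)"

definition sign_bit :: "int \<Rightarrow> nat" where
  "sign_bit a = (if a = 1 then 0 else if a = -1 then 1 else undefined)"

end

theory Submission imports Defs begin

text \<open>
  The odd-indexed entries of \<open>P\<^sub>f\<close> alternate in sign, so for every \<open>n\<close> exactly one of the
  steps from \<open>2n - 1\<close> to \<open>2n\<close> and from \<open>2n\<close> to \<open>2n + 1\<close> is a change of value. Hence the
  \<open>n\<close>-th run ends at \<open>2n\<close> or \<open>2n - 1\<close>, according to whether the product of the entries at
  \<open>2n - 1\<close> and \<open>2n\<close> is \<open>1\<close> or \<open>-1\<close>. The even-indexed entries form the paperfolding sequence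
  of the tail of \<open>f\<close>, and splitting this product once more by the parity of \<open>n\<close> identifies it
  as \<open>P\<^sub>g[n]\<close> with \<open>g = (f\<^sub>0 f\<^sub>1) (- f\<^sub>0 x)\<close>.
\<close>

section \<open>Runs of an arbitrary word on a set of positions\<close>

lemma is_run_const_block: "is_run D w i j \<Longrightarrow> const_block D w i j"
  by (simp add: is_run_def)

text \<open>The union of two overlapping constant blocks is again a constant block, so maximality
  forces both runs to equal it.\<close>

lemma is_run_unique:
  assumes r1: "is_run D w i j" and r2: "is_run D w i' j'"
    and k: "k \<in> {i..j}" "k \<in> {i'..j'}"
  shows "i = i' \<and> j = j'"
proof -
  have c: "const_block D w i j" "const_block D w i' j'"
    using r1 r2 by (simp_all add: is_run_def)
  have eq: "w l = w k" if "l \<in> {i..j} \<union> {i'..j'}" for l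
    using that c k unfolding const_block_def by (metis UnE)
  have un: "{min i i'..max j j'} = {i..j} \<union> {i'..j'}"
    using k by auto
  have "const_block D w (min i i') (max j j')"
    unfolding const_block_def
  proof (intro conjI ballI)
    show "min i i' \<le> max j j'" using k by auto
    show "{min i i'..max j j'} \<subseteq> D"
      using c unfolding un const_block_def by auto
    fix l assume "l \<in> {min i i'..max j j'}"
    moreover have "min i i' \<in> {min i i'..max j j'}" using k by auto
    ultimately show "w l = w (min i i')" using eq un by metis
  qed
  moreover have "{i..j} \<subseteq> {min i i'..max j j'}" "{i'..j'} \<subseteq> {min i i'..max j j'}" by auto
  ultimately show ?thesis
    using r1 r2 unfolding is_run_def by metis
qed

text \<open>Reduces maximality to a local test: any larger interval contains one of the two
  neighbouring positions.\<close>

lemma is_runI: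
  assumes c: "const_block D w i j"
    and left: "i - 1 \<in> D \<Longrightarrow> w (i - 1) \<noteq> w i" and pos: "0 < i"
    and right: "Suc j \<in> D \<Longrightarrow> w (Suc j) \<noteq> w j"
  shows "is_run D w i j"
  unfolding is_run_def
proof (intro conjI allI impI)
  fix i' j' assume a: "const_block D w i' j' \<and> {i..j} \<subseteq> {i'..j'}"
  have ij: "i \<le> j" using c by (simp add: const_block_def)
  then have le: "i' \<le> i" "j \<le> j'" using a by auto
  have eq: "w k = w l" "k \<in> D" if "k \<in> {i'..j'}" "l \<in> {i'..j'}" for k l
    using a that unfolding const_block_def by (metis, blast)
  show "i' = i"
  proof (rule ccontr)
    assume "i' \<noteq> i"
    then have "i - 1 \<in> {i'..j'}" "i \<in> {i'..j'}" using le ij by auto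
    with eq left show False by metis
  qed
  show "j' = j"
  proof (rule ccontr)
    assume "j' \<noteq> j"
    then have "Suc j \<in> {i'..j'}" "j \<in> {i'..j'}" using le ij by auto
    with eq right show False by metis
  qed
qed (fact c)

lemma finite_runs_before: "finite {(i', j'). is_run D w i' j' \<and> j' < i}"
  by (rule finite_subset[of _ "{..i} \<times> {..i}"])
     (auto simp: is_run_def const_block_def)

lemma card_runs_before_less:
  assumes "is_run D w i j" "j < i'"
  shows "card {(k, l). is_run D w k l \<and> l < i} < card {(k, l). is_run D w k l \<and> l < i'}"
proof (rule psubset_card_mono[OF finite_runs_before])
  have "i \<le> j" using assms by (simp add: is_run_def const_block_def)
  with assms have "(i, j) \<in> {(k, l). is_run D w k l \<and> l < i'} - {(k, l). is_run D w k l \<and> l < i}"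
    by simp
  moreover have "{(k, l). is_run D w k l \<and> l < i} \<subseteq> {(k, l). is_run D w k l \<and> l < i'}"
    using assms \<open>i \<le> j\<close> by auto
  ultimately show "{(k, l). is_run D w k l \<and> l < i} \<subset> {(k, l). is_run D w k l \<and> l < i'}"
    by blast
qed

text \<open>If one of two runs lay wholly to the left of the other, their counts of preceding runs
  would differ. Equal counts therefore make them overlap at the larger of the two starting points,
  hence coincide.\<close>

lemma run_end_eqI:
  assumes r: "is_run D w i e"
    and n: "card {(i', j'). is_run D w i' j' \<and> j' < i} + 1 = n"
  shows "run_end D w n = e"
  unfolding run_end_def
proof (rule the_equality)
  show "\<exists>i. is_run D w i e \<and> card {(i', j'). is_run D w i' j' \<and> j' < i} + 1 = n"
    using assms by blast
next
  fix e'
  assume "\<exists>i. is_run D w i e' \<and> card {(i', j'). is_run D w i' j' \<and> j' < i} + 1 = n"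
  then obtain i' where r': "is_run D w i' e'"
    and n': "card {(k, l). is_run D w k l \<and> l < i'} + 1 = n" by blast
  have "\<not> e < i'" "\<not> e' < i"
    using card_runs_before_less[OF r, of i'] card_runs_before_less[OF r', of i] n n' by auto
  moreover have "i \<le> e" "i' \<le> e'"
    using r r' by (simp_all add: is_run_def const_block_def)
  ultimately have "max i i' \<in> {i..e}" "max i i' \<in> {i'..e'}" by auto
  from is_run_unique[OF r r' this] show "e' = e" by simp
qed

text \<open>The blocks from \<open>Suc (e m)\<close> to \<open>e (Suc m)\<close> are runs, and every
  run ending by \<open>e n'\<close> has its last position in one of them and so is that block. Since
  \<open>D\<close> may extend past \<open>e M\<close>, this also applies to a prefix of an infinite
  word.\<close>

lemma run_end_boundaries:
  fixes e :: "nat \<Rightarrow> nat"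
  assumes e0: "e 0 = 0"
    and less: "\<And>m. m < M \<Longrightarrow> e m < e (Suc m)"
    and D: "{1..e M} \<subseteq> D" "0 \<notin> D"
    and change: "\<And>m. m < M \<Longrightarrow> w (Suc (e (Suc m))) \<noteq> w (e (Suc m))"
    and const: "\<And>m k. m < M \<Longrightarrow> e m < k \<Longrightarrow> k \<le> e (Suc m) \<Longrightarrow> w k = w (e (Suc m))"
    and n: "1 \<le> n" "n \<le> M"
  shows "run_end D w n = e n"
proof -
  have mono: "e k \<le> e l" if "k \<le> l" "l \<le> M" for k l
    using that
  proof (induction l rule: dec_induct)
    case (step l)
    then show ?case using less[of l] by simp
  qed simp
  have smono: "e k < e l" if "k < l" "l \<le> M" for k l
    using less[of k] mono[of "Suc k" l] that by simp
  have run: "is_run D w (Suc (e m)) (e (Suc m))" if m: "m < M" for m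
  proof (rule is_runI)
    have "{Suc (e m)..e (Suc m)} \<subseteq> {1..e M}"
      using mono[of "Suc m" M] m by auto
    then have sub: "{Suc (e m)..e (Suc m)} \<subseteq> D" using D(1) by (rule subset_trans)
    have eq: "w k = w (Suc (e m))" if "k \<in> {Suc (e m)..e (Suc m)}" for k
    proof -
      have "w k = w (e (Suc m))" by (rule const[OF m]) (use that in auto)
      also have "\<dots> = w (Suc (e m))" by (rule const[OF m, symmetric]) (use less[OF m] in auto)
      finally show ?thesis .
    qed
    from less[OF m] have "Suc (e m) \<le> e (Suc m)" by simp
    with sub eq show "const_block D w (Suc (e m)) (e (Suc m))"
      unfolding const_block_def by blast
    show "w (Suc (e m) - 1) \<noteq> w (Suc (e m))" if "Suc (e m) - 1 \<in> D"
    proof (cases m)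
      \<comment> \<open>The left neighbour of the first block is position \<open>0\<close>, which
        lies outside \<open>D\<close>.\<close>
      case 0
      with that e0 D show ?thesis by simp
    next
      case (Suc m')
      with change[of m'] m show ?thesis by simp
    qed
    show "w (Suc (e (Suc m))) \<noteq> w (e (Suc m))" by (rule change[OF m])
  qed simp
  obtain n' where n': "n = Suc n'" "n' < M" using n by (cases n) auto
  have "{(i', j'). is_run D w i' j' \<and> j' < Suc (e n')}
      = (\<lambda>m. (Suc (e m), e (Suc m))) ` {..<n'}" (is "?A = ?B")
  proof (intro equalityI subsetI)
    fix p assume "p \<in> ?A"
    then obtain i j where p: "p = (i, j)" and r: "is_run D w i j" and j: "j \<le> e n'" by auto
    have ij: "i \<le> j" "j \<in> D" using is_run_const_block[OF r] by (auto simp: const_block_def)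
    have "\<exists>m<n'. e m < j \<and> j \<le> e (Suc m)"
    proof -
      \<comment> \<open>The first boundary at or after \<open>j\<close> closes the block that
        contains \<open>j\<close>.\<close>
      define l where "l = (LEAST l. j \<le> e l)"
      have l: "j \<le> e l" "l \<le> n'" using j unfolding l_def by (auto intro: LeastI Least_le)
      have "l \<noteq> 0" using l e0 ij D by (metis le_zero_eq)
      then obtain m where m: "l = Suc m" by (cases l) auto
      then have "\<not> j \<le> e m" using not_less_Least[of m "\<lambda>l. j \<le> e l"] by (simp add: l_def)
      with l m show ?thesis by (intro exI[of _ m]) auto
    qed
    then obtain m where m: "m < n'" "e m < j" "j \<le> e (Suc m)" by blast
    have "m < M" using m n' by simp
    from is_run_unique[OF r run[OF this], of j] ij m p show "p \<in> ?B" by auto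
  next
    fix p assume "p \<in> ?B"
    then obtain m where m: "m < n'" "p = (Suc (e m), e (Suc m))" by auto
    then show "p \<in> ?A" using run[of m] mono[of "Suc m" n'] n' by auto
  qed
  moreover have "inj_on (\<lambda>m. (Suc (e m), e (Suc m))) {..<n'}"
  proof (rule inj_onI)
    fix k l assume kl: "k \<in> {..<n'}" "l \<in> {..<n'}"
      and eq: "(Suc (e k), e (Suc k)) = (Suc (e l), e (Suc l))"
    show "k = l"
      using smono[of k l] smono[of l k] kl eq n' by (cases k l rule: linorder_cases) auto
  qed
  ultimately have "card {(i', j'). is_run D w i' j' \<and> j' < Suc (e n')} + 1 = n"
    by (simp add: card_image n')
  from run_end_eqI[OF run[OF n'(2)] this] n' show ?thesis by simp
qed

text \<open>Each run contains exactly one odd position: consecutive odd entries differ, and an even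
  entry agrees with just one of its two odd neighbours. Comparing it with the left neighbour decides
  which run it joins.\<close>

lemma run_end_alternating_odd:
  fixes w :: "nat \<Rightarrow> int"
  assumes D: "{1..2 * M + 1} \<subseteq> D" "0 \<notin> D"
    and w: "\<And>k. k \<in> {1..2 * M + 1} \<Longrightarrow> w k \<in> {-1, 1}"
    and alt: "\<And>m. m < M \<Longrightarrow> w (2 * m + 3) = - w (2 * m + 1)"
    and n: "1 \<le> n" "n \<le> M"
  shows "run_end D w n = (if w (2 * n) = w (2 * n - 1) then 2 * n else 2 * n - 1)"
proof -
  define e where
    "e m = (if m = 0 then 0 else if w (2 * m) = w (2 * m - 1) then 2 * m else 2 * m - 1)" for m
  have e_le: "e m \<le> 2 * m" for m by (simp add: e_def)
  have e_Suc: "e (Suc m) = (if w (2 * m + 2) = w (2 * m + 1) then 2 * m + 2 else 2 * m + 1)" for m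
    by (simp add: e_def)
  have "run_end D w n = e n"
  proof (rule run_end_boundaries[where M = M])
    show "e 0 = 0" by (simp add: e_def)
    show "e m < e (Suc m)" for m using e_le[of m] by (simp add: e_Suc)
    show "{1..e M} \<subseteq> D" using D(1) e_le[of M] by auto
    show "w (Suc (e (Suc m))) \<noteq> w (e (Suc m))" if "m < M" for m
      using alt[OF that] w[of "2 * m + 1"] that by (auto simp: e_Suc eval_nat_numeral)
    show "w k = w (e (Suc m))" if m: "m < M" and k: "e m < k" "k \<le> e (Suc m)" for m k
    proof -
      have last: "w (e (Suc m)) = w (2 * m + 1)" by (simp add: e_Suc)
      have "2 * m \<le> Suc (e m)" by (simp add: e_def)
      then have "2 * m \<le> k" using k by simp
      moreover have "k \<le> 2 * m + 2" using k e_le[of "Suc m"] by simp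
      ultimately consider "k = 2 * m" | "k = 2 * m + 1" | "k = 2 * m + 2" by linarith
      then show ?thesis
      proof cases
        case 1
        \<comment> \<open>Position \<open>2 * m\<close> is in this block only if the previous run
          stopped at \<open>2 * m - 1\<close>. The entries there then differ, and with two values
          available the even entry equals the next odd one.\<close>
        with k have "m \<noteq> 0" by auto
        then obtain l where l: "m = Suc l" by (cases m) auto
        have "w (2 * l + 2) \<noteq> w (2 * l + 1)"
          using k 1 by (auto simp: l e_Suc)
        moreover have "w (2 * l + 3) = - w (2 * l + 1)" using alt[of l] m l by simp
        moreover have "w (2 * l + 1) \<in> {-1, 1}" "w (2 * l + 2) \<in> {-1, 1}"
          using w[of "2 * l + 1"] w[of "2 * l + 2"] m l by auto
        ultimately have "w (2 * l + 2) = w (2 * l + 3)" by auto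
        then show ?thesis unfolding last using 1 l by (simp add: eval_nat_numeral)
      next
        case 2
        then show ?thesis by (simp add: last)
      next
        case 3
        then show ?thesis using k by (auto simp: e_Suc split: if_splits)
      qed
    qed
  qed (use D n in auto)
  then show ?thesis using n by (simp add: e_def)
qed

section \<open>Symmetry and parity structure of finite paperfolding sequences\<close>

lemma Suc_length_paperfold: "Suc (length (paperfold f)) = 2 ^ length f"
  by (simp add: length_paperfold)

lemma length_paperfold_Cons: "length (paperfold (a # f)) = 2 * length (paperfold f) + 1"
  using Suc_length_paperfold[of "a # f"] Suc_length_paperfold[of f] by simp

lemma paperfold_map_mult: "paperfold (map ((*) s) f) = map ((*) s) (paperfold f)"
  by (induction f rule: rev_induct) (simp_all add: rev_map)

lemma set_paperfold: "set f \<subseteq> {-1, 1} \<Longrightarrow> set (paperfold f) \<subseteq> {-1, 1}"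
  by (induction f rule: rev_induct) auto

text \<open>The last fold makes the word antisymmetric about its central index
  \<open>length (paperfold f)\<close>.\<close>

lemma paperfold_snoc_nth_reflect:
  assumes "length (paperfold f) < i" "i \<le> 2 * length (paperfold f)"
  shows "paperfold (f @ [a]) ! i = - (paperfold f ! (2 * length (paperfold f) - i))"
proof -
  let ?p = "paperfold f"
  have "i - length ?p - 1 < length ?p"
    "length ?p - Suc (i - length ?p - 1) = 2 * length ?p - i" using assms by linarith+
  then show ?thesis
    using assms by (simp add: nth_append nth_Cons' rev_nth)
qed

text \<open>List indices start at 0, so even indices here are odd positions. The recursion appends
  at the end of \<open>f\<close> while the claim concerns its head; the induction works because
  reflection about the centre preserves the parity of an index.\<close>

lemma paperfold_Cons_nth:
  "2 * j < length (paperfold (a # f)) \<Longrightarrow> paperfold (a # f) ! (2 * j) = a * (-1) ^ j"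
  "j < length (paperfold f) \<Longrightarrow> paperfold (a # f) ! (2 * j + 1) = paperfold f ! j"
proof (induction f arbitrary: j rule: rev_induct)
  case Nil
  {
    case 1
    then show ?case by (simp add: length_paperfold paperfold_def)
  next
    case 2
    then show ?case by simp
  }
next
  case (snoc b f)
  let ?p = "paperfold (a # f)" and ?q = "paperfold f"
  have len: "length ?p = 2 * length ?q + 1"
    by (rule length_paperfold_Cons)
  have P: "paperfold (a # f @ [b]) = ?p @ [b] @ map uminus (rev ?p)"
    using paperfold_snoc[of "a # f" b] by simp
  {
    case 1
    show ?case
    proof (cases "2 * j < length ?p")
      case True
      then show ?thesis using snoc.IH(1) by (simp add: P nth_append)
    next
      case False
      define j' where "j' = length ?p - j"
      \<comment> \<open>The inequality is strict because \<open>length ?p\<close> is odd, so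
        \<open>2 * j\<close> is not the centre.\<close>
      have j: "length ?p < 2 * j" "2 * j \<le> 2 * length ?p"
        using False 1 len by (auto simp: P) presburger
      have j': "j + j' = length ?p" "2 * j' < length ?p" "2 * length ?p - 2 * j = 2 * j'"
        using j by (auto simp: j'_def)
      \<comment> \<open>As \<open>j + j'\<close> is odd, the two alternating signs are opposite,
        which cancels the negation made by the reflection.\<close>
      have "(-1 :: int) ^ j * (-1) ^ j' = -1"
        using j'(1) len by (simp flip: power_add)
      then have "- ((-1 :: int) ^ j') = (-1) ^ j"
        by (cases "even j"; cases "even j'") auto
      moreover have "paperfold (a # f @ [b]) ! (2 * j) = - (?p ! (2 * j'))"
        using paperfold_snoc_nth_reflect[of "a # f" "2 * j" b] j j'(3) by simp
      ultimately show ?thesis using snoc.IH(1)[OF j'(2)] by (metis mult_minus_right)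
    qed
  next
    case 2
    consider "j < length ?q" | "j = length ?q" | "length ?q < j" by linarith
    then show ?case
    proof cases
      case 1
      then show ?thesis using snoc.IH(2) len by (simp add: P nth_append)
    next
      case 2
      then show ?thesis using len by (simp add: P nth_append)
    next
      case 3
      define j' where "j' = 2 * length ?q - j"
      have j: "j \<le> 2 * length ?q" using 2 by simp
      \<comment> \<open>Reflecting \<open>2 * j + 1\<close> in the long word corresponds to
        reflecting \<open>j\<close> in the short one.\<close>
      have j': "j' < length ?q" "2 * length ?p - (2 * j + 1) = 2 * j' + 1"
        using 3 j len by (auto simp: j'_def)
      have "paperfold (a # f @ [b]) ! (2 * j + 1) = - (?p ! (2 * j' + 1))"
        using paperfold_snoc_nth_reflect[of "a # f" "2 * j + 1" b] 3 j j'(2) len by simp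
      also have "\<dots> = - (?q ! j')" using snoc.IH(2)[OF j'(1)] by simp
      also have "\<dots> = paperfold (f @ [b]) ! j"
        using paperfold_snoc_nth_reflect[of f j b] 3 j by (simp add: j'_def)
      finally show ?thesis .
    qed
  }
qed

lemma pf_nth_Cons_odd: "2 * m + 1 < 2 ^ Suc (length f) \<Longrightarrow> pf_nth (a # f) (2 * m + 1) = a * (-1) ^ m"
  using paperfold_Cons_nth(1)[of m a f] by (simp add: pf_nth_def length_paperfold)

lemma pf_nth_Cons_even:
  assumes "1 \<le> m" "m < 2 ^ length f"
  shows "pf_nth (a # f) (2 * m) = pf_nth f m"
proof -
  have "2 * m - 1 = 2 * (m - 1) + 1" using assms by simp
  then show ?thesis
    using paperfold_Cons_nth(2)[of "m - 1" f a] assms by (simp add: pf_nth_def length_paperfold)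
qed

lemma pf_nth_in: "set f \<subseteq> {-1, 1} \<Longrightarrow> 1 \<le> k \<Longrightarrow> k < 2 ^ length f \<Longrightarrow> pf_nth f k \<in> {-1, 1}"
  using subsetD[OF set_paperfold[of f] nth_mem[of "k - 1" "paperfold f"]]
  by (simp add: pf_nth_def length_paperfold)

lemma pf_nth_map_mult:
  "1 \<le> k \<Longrightarrow> k < 2 ^ length f \<Longrightarrow> pf_nth (map ((*) s) f) k = s * pf_nth f k"
  by (simp add: pf_nth_def paperfold_map_mult length_paperfold)

section \<open>The companion as a product of adjacent entries\<close>

lemma companion_Cons_Cons:
  "a \<in> {-1, 1} \<Longrightarrow> b \<in> {-1, 1} \<Longrightarrow> companion (a # b # x) = (a * b) # map ((*) (- a)) x"
  by (auto simp: companion_def numeral_2_eq_2 map_idI)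

text \<open>For \<open>n = 2 * m\<close> both sides are \<open>- a * pf_nth x m\<close>, the minus
  sign on the right coming from the odd position \<open>2 * n - 1\<close>. For
  \<open>n = 2 * m + 1\<close> both are \<open>a * b * (-1) ^ m\<close>.\<close>

lemma pf_nth_companion:
  assumes f: "set f \<subseteq> {-1, 1}" "2 \<le> length f" and n: "1 \<le> n" "n < 2 ^ (length f - 1)"
  shows "pf_nth (companion f) n = pf_nth f (2 * n - 1) * pf_nth f (2 * n)"
proof -
  obtain a b x where x: "f = a # b # x"
    using f(2) by (cases f; cases "tl f") auto
  have g: "companion f = (a * b) # map ((*) (- a)) x"
    using f(1) by (simp add: x companion_Cons_Cons)
  have "pf_nth f (2 * (n - 1) + 1) = a * (-1) ^ (n - 1)"
    unfolding x using n by (intro pf_nth_Cons_odd) (simp add: x)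
  then have odd: "pf_nth f (2 * n - 1) = a * (-1) ^ (n - 1)"
    using n by (cases n) simp_all
  have even: "pf_nth f (2 * n) = pf_nth (b # x) n"
    unfolding x using n by (intro pf_nth_Cons_even) (simp_all add: x)
  show ?thesis
  proof (cases "even n")
    case True
    then obtain m where m: "n = 2 * m" by blast
    with n x have m': "1 \<le> m" "m < 2 ^ length x" by auto
    have "pf_nth (b # x) n = pf_nth x m"
      using pf_nth_Cons_even[OF m'] by (simp add: m)
    moreover have "pf_nth (companion f) n = - a * pf_nth x m"
      using m' by (simp add: g m pf_nth_Cons_even pf_nth_map_mult)
    moreover have "(-1 :: int) ^ (n - 1) = -1" using m m' by simp
    ultimately show ?thesis unfolding odd even by simp
  next
    case False
    then obtain m where m: "n = 2 * m + 1" by (elim oddE)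
    with n x have m': "2 * m + 1 < 2 ^ Suc (length x)" by simp
    show ?thesis
      using pf_nth_Cons_odd[OF m', of b] pf_nth_Cons_odd[of m "map ((*) (- a)) x" "a * b"] m'
      unfolding odd even unfolding g m by simp
  qed
qed

text \<open>
  The word \<open>w\<close> on \<open>D\<close> only has to start with \<open>P\<^sub>f\<close>: this covers both \<open>P\<^sub>f\<close> itself and
  every infinite paperfolding sequence of which \<open>P\<^sub>f\<close> is a prefix.
\<close>

lemma run_end_paperfold_prefix:
  assumes f: "set f \<subseteq> {-1, 1}" "2 \<le> length f" and n: "1 \<le> n" "n < 2 ^ (length f - 1)"
    and D: "{1..length (paperfold f)} \<subseteq> D" "0 \<notin> D"
    and w: "\<And>k. k \<in> {1..length (paperfold f)} \<Longrightarrow> w k = pf_nth f k"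
  shows "run_end D w n + sign_bit (pf_nth (companion f) n) = 2 * n"
proof -
  \<comment> \<open>\<open>M\<close> counts the even positions of the odd-length word, so the range
    of \<open>n\<close> is exactly 1 to \<open>M\<close>.\<close>
  define M :: nat where "M = 2 ^ (length f - 1) - 1"
  obtain a x where x: "f = a # x" using f(2) by (cases f) auto
  have len: "length (paperfold f) = 2 * M + 1"
    unfolding x length_paperfold_Cons by (simp add: M_def x length_paperfold)
  have lt: "k < 2 ^ length f" if "k \<le> 2 * M + 1" for k
    using that len Suc_length_paperfold[of f] by simp
  have in_pm: "w k \<in> {-1, 1}" if "k \<in> {1..2 * M + 1}" for k
    using that w[of k] pf_nth_in[OF f(1), of k] lt[of k] by (simp add: len)
  have alt: "w (2 * m + 3) = - w (2 * m + 1)" if "m < M" for m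
  proof -
    have "w (2 * m + 3) = pf_nth f (2 * Suc m + 1)" "w (2 * m + 1) = pf_nth f (2 * m + 1)"
      using that w by (simp_all add: len eval_nat_numeral)
    moreover have "2 * Suc m + 1 < 2 ^ Suc (length x)"
      using lt[of "2 * Suc m + 1"] that by (simp add: x)
    ultimately show ?thesis
      unfolding x using pf_nth_Cons_odd[of "Suc m" x a] pf_nth_Cons_odd[of m x a] by simp
  qed
  have nM: "n \<le> M" using n by (simp add: M_def)
  have re: "run_end D w n = (if w (2 * n) = w (2 * n - 1) then 2 * n else 2 * n - 1)"
    by (rule run_end_alternating_odd[OF _ D(2) in_pm alt n(1) nM]) (use D(1) len in auto)
  have pos: "2 * n - 1 \<in> {1..2 * M + 1}" "2 * n \<in> {1..2 * M + 1}"
    using n nM by auto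
  \<comment> \<open>For entries 1 and -1 the product is 1 exactly when they agree, and it never
    reaches the undefined case of \<open>sign_bit\<close>.\<close>
  then have "pf_nth (companion f) n = w (2 * n - 1) * w (2 * n)"
    using pf_nth_companion[OF f n] w unfolding len by presburger
  with re in_pm[OF pos(1)] in_pm[OF pos(2)] show ?thesis
    using n(1) by (auto simp: sign_bit_def)
qed

section \<open>Passage from finite prefixes to infinite sequences\<close>

lemma pf_inf_nth_eq_stake:
  assumes "1 \<le> k" "k < 2 ^ N" "1 \<le> N"
  shows "pf_inf_nth f k = pf_nth (stake N f) k"
proof -
  \<comment> \<open>The defining property of \<open>paperfold_inf\<close> speaks only of nonempty
    prefixes of \<open>f\<close>.\<close>
  obtain N' where N: "N = Suc N'" using assms by (cases N) auto
  have "stake (length (paperfold (stake N f))) (paperfold_inf f) = paperfold (stake N f)"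
    using theI'[OF paperfold_inf_ex1[of f]] unfolding paperfold_inf_def N by blast
  moreover have "k - 1 < length (paperfold (stake N f))"
    using assms by (simp add: length_paperfold)
  ultimately show ?thesis
    unfolding pf_inf_nth_def pf_nth_def by (metis stake_nth)
qed

text \<open>The rule replaces two letters by one, so the prefix of \<open>f\<close> is one letter
  longer. The alphabet hypothesis excludes the undefined branches.\<close>

lemma stake_companion_inf:
  assumes "sset f \<subseteq> {-1, 1}"
  shows "stake (Suc N) (companion_inf f) = companion (stake (Suc (Suc N)) f)"
proof -
  have "shd f \<in> sset f" "shd (stl f) \<in> sset f"
    by (auto intro: shd_sset stl_sset)
  with assms have "shd f \<in> {-1, 1}" "shd (stl f) \<in> {-1, 1}" by auto
  then show ?thesis
    by (auto simp: companion_inf_def companion_def numeral_2_eq_2 stake_smap)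
qed

theorem theorem3:
  "(\<forall>f :: int list. set f \<subseteq> {-1, 1} \<and> 2 \<le> length f \<longrightarrow>
      (\<forall>n. 1 \<le> n \<and> n < 2 ^ (length f - 1) \<longrightarrow>
        pf_run_end f n + sign_bit (pf_nth (companion f) n) = 2 * n)) \<and>
   (\<forall>f :: int stream. sset f \<subseteq> {-1, 1} \<longrightarrow>
      (\<forall>n\<ge>1. pf_inf_run_end f n + sign_bit (pf_inf_nth (companion_inf f) n) = 2 * n))"
proof (intro conjI allI impI)
  fix f :: "int list" and n :: nat
  assume "set f \<subseteq> {-1, 1} \<and> 2 \<le> length f" "1 \<le> n \<and> n < 2 ^ (length f - 1)"
  then show "pf_run_end f n + sign_bit (pf_nth (companion f) n) = 2 * n"
    unfolding pf_run_end_def by (intro run_end_paperfold_prefix) auto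
next
  fix f :: "int stream" and n :: nat
  assume f: "sset f \<subseteq> {-1, 1}" and n: "1 \<le> n"
  \<comment> \<open>With \<open>n + 2\<close> letters the finite bound becomes
    \<open>n < 2 ^ Suc n\<close>, which always holds.\<close>
  define p where "p = stake (Suc (Suc n)) f"
  have n_less: "n < 2 ^ Suc n" using less_exp[of n] unfolding power_Suc by linarith
  have "pf_inf_nth (companion_inf f) n = pf_nth (companion p) n"
    unfolding p_def stake_companion_inf[OF f, symmetric]
    by (rule pf_inf_nth_eq_stake) (use n n_less in auto)
  moreover have "run_end {1..} (pf_inf_nth f) n + sign_bit (pf_nth (companion p) n) = 2 * n"
  proof (rule run_end_paperfold_prefix)
    have "set p \<subseteq> sset f"
      unfolding p_def by (metis sset_shift stake_sdrop Un_upper1)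
    with f show "set p \<subseteq> {-1, 1}" by blast
    show "n < 2 ^ (length p - 1)" using n_less by (simp add: p_def)
    show "pf_inf_nth f k = pf_nth p k" if "k \<in> {1..length (paperfold p)}" for k
      unfolding p_def
    proof (rule pf_inf_nth_eq_stake)
      have "k \<le> 2 ^ Suc (Suc n) - 1" using that by (simp add: p_def length_paperfold)
      moreover have "(0 :: nat) < 2 ^ Suc (Suc n)" by simp
      ultimately show "k < 2 ^ Suc (Suc n)" by linarith
    qed (use that in auto)
  qed (use n in \<open>auto simp: p_def\<close>)
  ultimately show "pf_inf_run_end f n + sign_bit (pf_inf_nth (companion_inf f) n) = 2 * n"
    by (simp add: pf_inf_run_end_def)
qed

end
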